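(* Let $\mathcal{T}=\{(0,0),(1,0),(1/2,\sqrt{3}/2)\}\subset\mathbb{E}^2$. For any finite coloring of $\mathbb{E}^2$ there exist uncountably many $r\in\mathbb{R}^+$ such that there exist uncountably many monochromatic equilateral triangles with side length $r$ homothetic to $\mathcal{T}$. Furthermore, for any 2-coloring of the unit square $[0,1]\times[0,1]$ there exist uncountably many $r\in(0,1]$ such that there exist uncountably many monochromatic equilateral triangles (with vertices in the unit square) of side length $r$ homothetic to $\mathcal{T}$.
   Context: $\mathbb{E}^2$ denotes the Euclidean plane, identified with $\mathbb{R}^2$, and $\mathbb{R}^+$ is the set of positive reals. A finite coloring of a set $X\subset\mathbb{E}^2$ is a map $\chi:X\to\{1,\ldots,k\}$ for some positive integer $k$; it is a 2-coloring if $k=2$. A subset of $X$ is monochromatic if $\chi$ is constant on it. A triangle is regarded as the set of its three vertices, so a triangle is monochromatic if its three vertices have the same color. A set $A\subset\mathbb{E}^2$ is homothetic to a set $B\subset\mathbb{E}^2$ if $A$ can be mapped onto $B$ by a translation and a dilation (scaling by a positive real factor), i.e. $B=v+\lambda A$ for some $v\in\mathbb{R}^2$ and some real $\lambda>0$. *)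

theory Defs
  imports "HOL-Analysis.Analysis"
begin

text \<open>
  The Euclidean plane is the type \<^typ>\<open>real \<times> real\<close>; its library metric is the Euclidean one.
\<close>

type_synonym plane = "real \<times> real"

definition coloring :: "nat \<Rightarrow> plane set \<Rightarrow> (plane \<Rightarrow> nat) \<Rightarrow> bool" where
  "coloring k X col \<longleftrightarrow> k > 0 \<and> col \<in> X \<rightarrow> {1..k}"

definition finite_coloring :: "plane set \<Rightarrow> (plane \<Rightarrow> nat) \<Rightarrow> bool" where
  "finite_coloring X col \<longleftrightarrow> (\<exists>k. coloring k X col)"

text \<open>
  A coloring of \<open>X\<close> is a total function with arbitrary values off \<open>X\<close>, so a monochromatic
  set is required to lie in \<open>X\<close>.
\<close>

definition monochromatic :: "plane set \<Rightarrow> (plane \<Rightarrow> nat) \<Rightarrow> plane set \<Rightarrow> bool" where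
  "monochromatic X col S \<longleftrightarrow> S \<subseteq> X \<and> col constant_on S"

definition homothetic :: "plane set \<Rightarrow> plane set \<Rightarrow> bool" where
  "homothetic A B \<longleftrightarrow> (\<exists>v l. l > 0 \<and> B = (\<lambda>x. v + l *\<^sub>R x) ` A)"

text \<open>A triangle is the set of its three vertices, so triangles are counted as sets.\<close>

definition equilateral_triangle :: "real \<Rightarrow> plane set \<Rightarrow> bool" where
  "equilateral_triangle r S \<longleftrightarrow> r > 0 \<and>
     (\<exists>a b c. S = {a, b, c} \<and> dist a b = r \<and> dist b c = r \<and> dist c a = r)"

definition unit_triangle :: "plane set" where
  "unit_triangle = {(0, 0), (1, 0), (1 / 2, sqrt 3 / 2)}"

definition mono_triangles :: "plane set \<Rightarrow> (plane \<Rightarrow> nat) \<Rightarrow> real \<Rightarrow> plane set set" where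
  "mono_triangles X col r =
     {S. monochromatic X col S \<and> equilateral_triangle r S \<and> homothetic S unit_triangle}"

end

theory Submission
  imports Defs
begin

text \<open>
  By color focusing, every coloring of a large enough finite grid with boundedly many colors has a
  monochromatic corner \<open>(x, y), (x + d, y), (x, y + d)\<close>. The grid is mapped affinely onto a piece
  of the triangular lattice with mesh \<open>t\<close> and origin \<open>(\<alpha>, 0)\<close>, so that corners become homothetic
  copies of the triangle. For fixed small \<open>t\<close> only finitely many corners \<open>(x, y, d)\<close> compete for
  uncountably many \<open>\<alpha>\<close>, so one of them is monochromatic for uncountably many \<open>\<alpha>\<close>, and the side
  length \<open>d * t\<close> is good. As \<open>d\<close> is bounded independently of \<open>t\<close>, uncountably many \<open>t\<close> yield
  uncountably many good side lengths.
\<close>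

section \<open>Monochromatic corners in colored grids\<close>

definition corner_in :: "nat \<Rightarrow> (nat \<Rightarrow> nat \<Rightarrow> 'c) \<Rightarrow> nat \<Rightarrow> nat \<Rightarrow> nat \<Rightarrow> bool" where
  "corner_in N c x y d \<longleftrightarrow> d > 0 \<and> x + d \<le> N \<and> y + d \<le> N \<and>
     c (x + d) y = c x y \<and> c x (y + d) = c x y"

text \<open>A horizontal edge of color \<open>q\<close> whose completion to a corner has the third vertex \<open>(a, b)\<close>.\<close>

definition edge_focused_at :: "nat \<Rightarrow> (nat \<Rightarrow> nat \<Rightarrow> 'c) \<Rightarrow> nat \<Rightarrow> nat \<Rightarrow> 'c \<Rightarrow> bool" where
  "edge_focused_at N c a b q \<longleftrightarrow>
     (\<exists>y d. d > 0 \<and> b = y + d \<and> a + d \<le> N \<and> c a y = q \<and> c (a + d) y = q)"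

text \<open>Pigeonhole: \<open>M\<close> is the number of colorings of an \<open>N + 1\<close> by
  \<open>N + 1\<close> block with colors in \<open>K\<close>, so two of the blocks at the
  \<open>M + 1\<close> horizontal offsets from \<open>0\<close> to \<open>M\<close> are colored
  alike.\<close>

lemma equal_shifted_blocks:
  assumes "finite K"
  obtains M where "\<And>c :: nat \<Rightarrow> nat \<Rightarrow> 'c. (\<And>x y. x \<le> N + M \<Longrightarrow> y \<le> N \<Longrightarrow> c x y \<in> K) \<Longrightarrow>
    \<exists>u d. d > 0 \<and> u + d \<le> M \<and> (\<forall>x\<le>N. \<forall>y\<le>N. c (x + u + d) y = c (x + u) y)"
proof
  define B where "B = {..N} \<times> {..N}"
  define P where "P = (B \<rightarrow>\<^sub>E K)"
  have finP: "finite P"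
    unfolding P_def B_def using assms by (intro finite_PiE) auto
  fix c :: "nat \<Rightarrow> nat \<Rightarrow> 'c"
  assume c: "\<And>x y. x \<le> N + card P \<Longrightarrow> y \<le> N \<Longrightarrow> c x y \<in> K"
  define g where "g j = restrict (\<lambda>(x, y). c (x + j) y) B" for j
  have "g ` {..card P} \<subseteq> P"
    using c by (auto simp: g_def P_def B_def split: if_splits)
  then have "\<not> inj_on g {..card P}"
    using card_inj_on_le[OF _ _ finP, of g "{..card P}"] by auto
  then obtain i j where ij: "i < j" "j \<le> card P" "g i = g j"
    unfolding inj_on_def by (metis atMost_iff linorder_neqE_nat)
  have "c (x + i + (j - i)) y = c (x + i) y" if "x \<le> N" "y \<le> N" for x y
    using fun_cong[OF ij(3), of "(x, y)"] that ij by (simp add: g_def B_def)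
  then show "\<exists>u d. d > 0 \<and> u + d \<le> card P \<and>
      (\<forall>x\<le>N. \<forall>y\<le>N. c (x + u + d) y = c (x + u) y)"
    using ij by (intro exI[of _ i] exI[of _ "j - i"]) auto
qed

text \<open>Induction on \<open>r\<close>. Two equal blocks at horizontal distance \<open>d\<close>
  allow every focused edge to be lengthened by \<open>d\<close>. This moves the common focus up by
  \<open>d\<close>, where the color of the old focus joins the focused colors.\<close>

lemma color_focusing:
  assumes "finite K"
  shows "\<exists>N. \<forall>c :: nat \<Rightarrow> nat \<Rightarrow> 'c. (\<forall>x\<le>N. \<forall>y\<le>N. c x y \<in> K) \<longrightarrow>
    (\<exists>x y d. corner_in N c x y d) \<or>
    (\<exists>a b C. a \<le> N \<and> b \<le> N \<and> C \<subseteq> K \<and> card C = r \<and> (\<forall>q\<in>C. edge_focused_at N c a b q))"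
proof (induction r)
  case 0
  show ?case by (rule exI[of _ 0]) force
next
  case (Suc r)
  then obtain N where N: "\<And>c :: nat \<Rightarrow> nat \<Rightarrow> 'c. (\<forall>x\<le>N. \<forall>y\<le>N. c x y \<in> K) \<Longrightarrow>
    (\<exists>x y d. corner_in N c x y d) \<or>
    (\<exists>a b C. a \<le> N \<and> b \<le> N \<and> C \<subseteq> K \<and> card C = r \<and> (\<forall>q\<in>C. edge_focused_at N c a b q))"
    by blast
  obtain M where M: "\<And>c :: nat \<Rightarrow> nat \<Rightarrow> 'c.
      (\<And>x y. x \<le> N + M \<Longrightarrow> y \<le> N \<Longrightarrow> c x y \<in> K) \<Longrightarrow>
    \<exists>u d. d > 0 \<and> u + d \<le> M \<and> (\<forall>x\<le>N. \<forall>y\<le>N. c (x + u + d) y = c (x + u) y)"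
    using equal_shifted_blocks[OF assms, of N] by blast
  show ?case
  \<comment> \<open>Horizontally \<open>M\<close> makes room for the shifted blocks, vertically for
    the new focus, which lies \<open>d\<close> above the old one.\<close>
  proof (intro exI[of _ "N + M"] allI impI)
    fix c :: "nat \<Rightarrow> nat \<Rightarrow> 'c"
    assume c: "\<forall>x\<le>N + M. \<forall>y\<le>N + M. c x y \<in> K"
    obtain u d where u: "d > 0" "u + d \<le> M"
      and shift: "\<And>x y. x \<le> N \<Longrightarrow> y \<le> N \<Longrightarrow> c (x + u + d) y = c (x + u) y"
      using M[of c] c by (metis trans_le_add1)
    define c' where "c' x y = c (x + u) y" for x y
    have "\<forall>x\<le>N. \<forall>y\<le>N. c' x y \<in> K"
      using c u by (auto simp: c'_def)
    from N[OF this] show "(\<exists>x y d. corner_in (N + M) c x y d) \<or>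
      (\<exists>a b C. a \<le> N + M \<and> b \<le> N + M \<and> C \<subseteq> K \<and> card C = Suc r \<and>
        (\<forall>q\<in>C. edge_focused_at (N + M) c a b q))"
    proof (elim disjE exE conjE)
      fix x y s assume "corner_in N c' x y s"
      then have "corner_in (N + M) c (x + u) y s"
        using u by (auto simp: corner_in_def c'_def ac_simps)
      then show ?thesis by blast
    next
      fix a b C
      assume a: "a \<le> N" "b \<le> N" and C: "C \<subseteq> K" "card C = r"
        and foc: "\<forall>q\<in>C. edge_focused_at N c' a b q"
      let ?f = "c (a + u) b"
      show ?thesis
      \<comment> \<open>If the focus has one of the focused colors, it closes the edge of that color
        to a corner.\<close>
      proof (cases "?f \<in> C")
        case True
        then obtain y s where "s > 0" "b = y + s" "a + s \<le> N" "c' a y = ?f" "c' (a + s) y = ?f"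
          using foc by (auto simp: edge_focused_at_def)
        then have "corner_in (N + M) c (a + u) y s"
          using u a by (auto simp: corner_in_def c'_def ac_simps)
        then show ?thesis by blast
      next
        case False
        \<comment> \<open>The left end stays in the left block and the right end moves to its copy
          in the right block, so the length \<open>s\<close> becomes \<open>s + d\<close>.\<close>
        have "edge_focused_at (N + M) c (a + u) (b + d) q" if q: "q \<in> C" for q
        proof -
          obtain y s where "s > 0" "b = y + s" "a + s \<le> N" "c' a y = q" "c' (a + s) y = q"
            using foc q by (auto simp: edge_focused_at_def)
          moreover have "c (a + s + u + d) y = c (a + s + u) y"
            using calculation a by (intro shift) auto
          ultimately show ?thesis
            using u unfolding edge_focused_at_def c'_def
            by (intro exI[of _ y] exI[of _ "s + d"]) (auto simp: ac_simps)
        qed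
        \<comment> \<open>The old focus and its copy at distance \<open>d\<close> to the right form
          the edge of the new color.\<close>
        moreover have "edge_focused_at (N + M) c (a + u) (b + d) ?f"
          using u a shift[OF a] unfolding edge_focused_at_def
          by (intro exI[of _ b] exI[of _ d]) auto
        moreover have "card (insert ?f C) = Suc r"
          using False C finite_subset[OF C(1) assms] by simp
        moreover have "insert ?f C \<subseteq> K"
          using C c a u by auto
        moreover have "a + u \<le> N + M" "b + d \<le> N + M"
          using a u by auto
        ultimately show ?thesis by (metis insert_iff)
      qed
    qed
  qed
qed

text \<open>No set of \<open>card K + 1\<close> colors fits into \<open>K\<close>, so color focusing
  for that many colors leaves only the corner.\<close>

theorem monochromatic_corner:
  assumes "finite K"
  obtains N where "\<And>c :: nat \<Rightarrow> nat \<Rightarrow> 'c. (\<And>x y. x \<le> N \<Longrightarrow> y \<le> N \<Longrightarrow> c x y \<in> K) \<Longrightarrow>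
    \<exists>x y d. corner_in N c x y d"
proof -
  have "\<not> (C \<subseteq> K \<and> card C = Suc (card K))" for C
    using card_mono[OF assms, of C] by auto
  then show ?thesis
    using color_focusing[OF assms, of "Suc (card K)"] that by metis
qed

section \<open>Equilateral triangles and the triangular lattice\<close>

definition triangle_at :: "plane \<Rightarrow> real \<Rightarrow> plane set" where
  "triangle_at p r = {p, p + (r, 0), p + (r / 2, r * sqrt 3 / 2)}"

text \<open>The vertex \<open>p\<close> is least in both coordinates and so is determined by the
  vertex set. Hence different base points give different triangles even when these are counted as
  sets.\<close>

lemma triangle_at_inject:
  assumes "r > 0" "triangle_at p r = triangle_at q r"
  shows "p = q"
proof -
  have le: "fst a \<le> fst b \<and> snd a \<le> snd b" if "b \<in> triangle_at a r" for a b
    using that assms(1) by (auto simp: triangle_at_def)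
  have "p \<in> triangle_at p r" "q \<in> triangle_at q r"
    by (simp_all add: triangle_at_def)
  with assms(2) le show ?thesis
    by (metis order_antisym prod_eq_iff)
qed

lemma equilateral_triangle_at:
  assumes "r > 0"
  shows "equilateral_triangle r (triangle_at p r)"
proof -
  have "r\<^sup>2 / 4 + r\<^sup>2 * 3 / 4 = r\<^sup>2"
    by simp
  then have "dist p (p + (r, 0)) = r" "dist (p + (r, 0)) (p + (r / 2, r * sqrt 3 / 2)) = r"
    "dist (p + (r / 2, r * sqrt 3 / 2)) p = r"
    using assms by (cases p; simp add: dist_Pair_Pair dist_real_def power_mult_distrib power_divide)+
  with assms show ?thesis
    unfolding equilateral_triangle_def triangle_at_def by blast
qed

lemma homothetic_triangle_at:
  assumes "r > 0"
  shows "homothetic (triangle_at p r) unit_triangle"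
  unfolding homothetic_def
proof (intro exI conjI)
  show "1 / r > 0" using assms by simp
  show "unit_triangle = (\<lambda>x. - ((1 / r) *\<^sub>R p) + (1 / r) *\<^sub>R x) ` triangle_at p r"
    using assms
    by (cases p) (simp add: triangle_at_def unit_triangle_def scaleR_add_right field_simps
        zero_prod_def)
qed

lemma triangle_at_mono_triangles:
  assumes "r > 0" "triangle_at p r \<subseteq> X"
    and "col (p + (r, 0)) = col p" "col (p + (r / 2, r * sqrt 3 / 2)) = col p"
  shows "triangle_at p r \<in> mono_triangles X col r"
proof -
  have "col constant_on triangle_at p r"
    unfolding constant_on_def using assms by (auto simp: triangle_at_def)
  with assms show ?thesis
    by (simp add: mono_triangles_def monochromatic_def equilateral_triangle_at
        homothetic_triangle_at)
qed

definition lattice_point :: "real \<Rightarrow> real \<Rightarrow> nat \<Rightarrow> nat \<Rightarrow> plane" where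
  "lattice_point t \<alpha> x y = (\<alpha> + t * (x + y / 2), t * y * sqrt 3 / 2)"

text \<open>The two legs of a corner of size \<open>d\<close> become the two sides at
  \<open>p\<close> of \<open>triangle_at p (d * t)\<close>.\<close>

lemma lattice_point_add:
  "lattice_point t \<alpha> (x + d) y = lattice_point t \<alpha> x y + (d * t, 0)"
  "lattice_point t \<alpha> x (y + d) = lattice_point t \<alpha> x y + (d * t / 2, d * t * sqrt 3 / 2)"
  by (simp_all add: lattice_point_def field_simps)

text \<open>The bound on \<open>t\<close> gives \<open>t * N \<le> 1 / 4\<close>, so the abscissa is
  at most \<open>1/2 + 1/4 + 1/8\<close>.\<close>

lemma lattice_point_in_square:
  assumes "0 < t" "t \<le> 1 / (4 * real (Suc N))" "\<alpha> \<in> {0..1/2}" "x \<le> N" "y \<le> N"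
  shows "lattice_point t \<alpha> x y \<in> {0..1} \<times> {0..1}"
proof -
  have tN: "t * N \<le> 1 / 4"
    using assms(1,2) by (simp add: field_simps)
  have "t * x \<le> t * N" "t * y \<le> t * N"
    using assms by simp_all
  with tN have xy: "t * x \<le> 1 / 4" "t * y \<le> 1 / 4" by linarith+
  have "sqrt 3 \<le> 2"
    by (rule real_le_lsqrt) auto
  then have "t * y * sqrt 3 \<le> 1 / 4 * 2"
    using xy assms by (intro mult_mono) auto
  with xy assms show ?thesis
    by (auto simp: lattice_point_def distrib_left)
qed

section \<open>Counting triangles and side lengths\<close>

text \<open>All triangles are found inside the unit square, so that \<open>X\<close> can be the
  plane or the square, as the two halves of the theorem demand.\<close>

lemma uncountably_many_sides:
  assumes sq: "{0..1} \<times> {0..1} \<subseteq> X" and "finite K"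
    and col: "\<And>p. p \<in> {0..1} \<times> {0..1} \<Longrightarrow> col p \<in> K"
  shows "uncountable {r \<in> {0<..1}. uncountable (mono_triangles X col r)}"
proof
  let ?G = "{r \<in> {0<..1}. uncountable (mono_triangles X col r)}"
  assume count: "countable ?G"
  obtain N where N: "\<And>c. (\<And>x y. x \<le> N \<Longrightarrow> y \<le> N \<Longrightarrow> c x y \<in> K) \<Longrightarrow>
    \<exists>x y d. corner_in N c x y d"
    using monochromatic_corner[OF \<open>finite K\<close>] by blast
  \<comment> \<open>\<open>Suc N\<close> keeps \<delta> positive when \<open>N = 0\<close>.\<close>
  define \<delta> where "\<delta> = 1 / (4 * real (Suc N))"
  have good: "\<exists>d\<in>{1..N}. d * t \<in> ?G" if t: "t \<in> {0<..\<delta>}" for t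
  proof -
    define A where "A x y d = {\<alpha> \<in> {0..1/2}. corner_in N (\<lambda>x y. col (lattice_point t \<alpha> x y)) x y d}"
      for x y d
    have inS: "lattice_point t \<alpha> x y \<in> {0..1} \<times> {0..1}"
      if "\<alpha> \<in> {0..1/2}" "x \<le> N" "y \<le> N" for \<alpha> x y
      using that t by (intro lattice_point_in_square[of t N]) (auto simp: \<delta>_def)
    \<comment> \<open>Each offset \<alpha> has some corner, so finitely many sets
      \<open>A x y d\<close> cover an uncountable interval and one of them is uncountable.\<close>
    have "{0..1/2} \<subseteq> (\<Union>(x, y, d) \<in> {..N} \<times> {..N} \<times> {1..N}. A x y d)"
    proof
      fix \<alpha> :: real assume \<alpha>: "\<alpha> \<in> {0..1/2}"
      obtain x y d where "corner_in N (\<lambda>x y. col (lattice_point t \<alpha> x y)) x y d"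
        using N[of "\<lambda>x y. col (lattice_point t \<alpha> x y)"] col inS[OF \<alpha>] by blast
      with \<alpha> show "\<alpha> \<in> (\<Union>(x, y, d) \<in> {..N} \<times> {..N} \<times> {1..N}. A x y d)"
        by (intro UN_I[of "(x, y, d)"]) (auto simp: A_def corner_in_def)
    qed
    moreover have "uncountable {0..1/2 :: real}"
      by (simp add: uncountable_closed_interval)
    ultimately have "uncountable (\<Union>(x, y, d) \<in> {..N} \<times> {..N} \<times> {1..N}. A x y d)"
      using countable_subset by blast
    moreover have "countable (\<Union>(x, y, d) \<in> {..N} \<times> {..N} \<times> {1..N}. A x y d)"
      if "\<forall>x\<in>{..N}. \<forall>y\<in>{..N}. \<forall>d\<in>{1..N}. countable (A x y d)"
      using that by (intro countable_UN) auto
    ultimately obtain x y d where xyd: "x \<le> N" "y \<le> N" "d \<in> {1..N}"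
      and unc: "uncountable (A x y d)"
      by (meson atMost_iff)
    define r where "r = d * t"
    have r: "r > 0" using xyd t by (simp add: r_def)
    let ?T = "\<lambda>\<alpha>. triangle_at (lattice_point t \<alpha> x y) r"
    have "inj_on ?T (A x y d)"
      by (rule inj_onI, drule triangle_at_inject[OF r]) (simp add: lattice_point_def)
    then have "uncountable (?T ` A x y d)"
      using unc countable_image_inj_on by blast
    moreover have "?T ` A x y d \<subseteq> mono_triangles X col r"
    proof (intro image_subsetI triangle_at_mono_triangles r)
      fix \<alpha> assume "\<alpha> \<in> A x y d"
      then have \<alpha>: "\<alpha> \<in> {0..1/2}"
        and cor: "corner_in N (\<lambda>x y. col (lattice_point t \<alpha> x y)) x y d"
        by (auto simp: A_def)
      show "col (lattice_point t \<alpha> x y + (r, 0)) = col (lattice_point t \<alpha> x y)"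
        "col (lattice_point t \<alpha> x y + (r / 2, r * sqrt 3 / 2)) = col (lattice_point t \<alpha> x y)"
        using cor by (simp_all only: corner_in_def r_def lattice_point_add)
      have "?T \<alpha> =
        {lattice_point t \<alpha> x y, lattice_point t \<alpha> (x + d) y, lattice_point t \<alpha> x (y + d)}"
        by (simp add: triangle_at_def lattice_point_add r_def)
      also have "\<dots> \<subseteq> {0..1} \<times> {0..1}"
        using cor xyd inS[OF \<alpha>] unfolding corner_in_def by blast
      finally show "?T \<alpha> \<subseteq> X" using sq by blast
    qed
    ultimately have "uncountable (mono_triangles X col r)"
      using countable_subset by blast
    moreover have "r \<le> 1"
    proof -
      have "d * t \<le> N * \<delta>"
        using xyd t by (intro mult_mono) auto
      also have "\<dots> \<le> 1" by (simp add: \<delta>_def divide_le_eq)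
      finally show ?thesis by (simp only: r_def)
    qed
    ultimately have "r \<in> ?G"
      using r by simp
    then show ?thesis
      unfolding r_def by (rule bexI) (rule xyd(3))
  qed
  \<comment> \<open>Each \<open>t\<close> is recovered from a good side length by dividing by one of
    \<open>N\<close> integers, so countably many good lengths would make the interval
    countable.\<close>
  have "{0<..\<delta>} \<subseteq> (\<Union>d\<in>{1..N}. (\<lambda>r. r / d) ` ?G)"
  proof
    fix t assume t: "t \<in> {0<..\<delta>}"
    from good[OF t] obtain d where d: "d \<in> {1..N}" "d * t \<in> ?G" by (rule bexE)
    show "t \<in> (\<Union>d\<in>{1..N}. (\<lambda>r. r / d) ` ?G)"
      by (rule UN_I[OF d(1)], rule image_eqI[OF _ d(2)]) (use d(1) in simp)
  qed
  moreover have "countable (\<Union>d\<in>{1..N}. (\<lambda>r. r / d) ` ?G)"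
    using count by (intro countable_UN countable_image) auto
  ultimately have "countable {0<..\<delta>}"
    by (rule countable_subset)
  moreover have "\<delta> > 0" by (simp add: \<delta>_def)
  ultimately show False
    using uncountable_half_open_interval_2[of 0 \<delta>] by simp
qed

theorem theorem8:
  shows "(\<forall>col. finite_coloring UNIV col \<longrightarrow>
            uncountable {r. r > 0 \<and> uncountable (mono_triangles UNIV col r)})
       \<and> (\<forall>col. coloring 2 ({0..1} \<times> {0..1}) col \<longrightarrow>
            uncountable {r. r \<in> {0<..1} \<and>
              uncountable (mono_triangles ({0..1} \<times> {0..1}) col r)})"
proof (intro conjI allI impI)
  fix col assume "finite_coloring UNIV col"
  then obtain k where "\<And>p. col p \<in> {1..k}"
    unfolding finite_coloring_def coloring_def by blast
  then have "uncountable {r \<in> {0<..1}. uncountable (mono_triangles UNIV col r)}"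
    by (intro uncountably_many_sides[of _ "{1..k}"]) auto
  moreover have "{r \<in> {0<..1}. uncountable (mono_triangles UNIV col r)}
      \<subseteq> {r. r > 0 \<and> uncountable (mono_triangles UNIV col r)}"
    by auto
  ultimately show "uncountable {r. r > 0 \<and> uncountable (mono_triangles UNIV col r)}"
    using countable_subset by blast
next
  fix col assume "coloring 2 ({0..1} \<times> {0..1}) col"
  then show "uncountable {r. r \<in> {0<..1} \<and>
      uncountable (mono_triangles ({0..1} \<times> {0..1}) col r)}"
    unfolding coloring_def by (intro uncountably_many_sides[of _ "{1..2}"]) auto
qed

end
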